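(* Fix integers $n\ge d\ge 1$ and $\lambda\in(0,1)$, and let $X^n(\cdot)$ be the Markov chain on $S^n$ with the transition rates given in the context. If $X^n(0)=0$, then $X^n(s)\le_{st}X^n(t)$ for all $0\le s\le t$.
   Context: For integers $n\ge d$ let $[n]=\{1,\dots,n\}$ be the set of servers and $m=\binom{n}{d}$. The $m$ subsets of $[n]$ of size $d$ are called classes and are indexed by $i\in[m]$. For a class $i\in[m]$, $\partial_i\subset[n]$ denotes the corresponding set of $d$ servers; for a server $j\in[n]$, $\partial_j\subset[m]$ denotes the set of classes containing $j$. The chain is the continuous-time Markov chain on $S^n=\mathbb{Z}_+^m$ with transitions, from $x\in S^n$ and for each $i\in[m]$, $$x\to x+e_i\ \text{ at rate } r^{i,n}_+(x)=\frac{n\lambda}{m},\qquad x\to x-e_i\ \text{ at rate } r^{i,n}_-(x)=x_i\sum_{j\in\partial_i}\frac1{q_j},\qquad q_j=\sum_{i'\in\partial_j}x_{i'},$$ where $e_i$ is the $i$-th unit vector and $r^{i,n}_-(x)=0$ when $x_i=0$. For $x,y\in S^n$, $x\le y$ means $x_i\le y_i$ for all $i\in[m]$; $\le_{st}$ is the stochastic order on $S^n$-valued random variables induced by this partial order. *)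

theory Defs
  imports "HOL-Probability.Probability"
begin

section \<open>Continuous-time Markov chains on a countable state space\<close>

text \<open>\<open>p t x y\<close> is the probability to be in \<open>y\<close> at time \<open>t\<close> after a start in \<open>x\<close>.\<close>

definition transition_function :: "'s set \<Rightarrow> (real \<Rightarrow> 's \<Rightarrow> 's \<Rightarrow> real) \<Rightarrow> bool" where
  "transition_function S p \<longleftrightarrow>
     (\<forall>t\<ge>0. \<forall>x\<in>S. \<forall>y\<in>S. 0 \<le> p t x y) \<and>
     (\<forall>t\<ge>0. \<forall>x\<in>S. (p t x has_sum 1) S) \<and>
     (\<forall>x\<in>S. \<forall>y\<in>S. p 0 x y = (if x = y then 1 else 0)) \<and>
     (\<forall>s\<ge>0. \<forall>t\<ge>0. \<forall>x\<in>S. \<forall>z\<in>S. ((\<lambda>y. p s x y * p t y z) has_sum p (s + t) x z) S)"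

text \<open>The conservative generator (Q-matrix) of the off-diagonal jump rates \<open>r\<close>; the values
  \<open>r x x\<close> play no role. The infinite sum is meaningful only if the total jump rate out of
  \<open>x\<close> is finite.\<close>

definition generator :: "'s set \<Rightarrow> ('s \<Rightarrow> 's \<Rightarrow> real) \<Rightarrow> 's \<Rightarrow> 's \<Rightarrow> real" where
  "generator S r x y = (if x = y then - (\<Sum>\<^sub>\<infinity>z\<in>S - {x}. r x z) else r x y)"

definition has_jump_rates ::
  "'s set \<Rightarrow> (real \<Rightarrow> 's \<Rightarrow> 's \<Rightarrow> real) \<Rightarrow> ('s \<Rightarrow> 's \<Rightarrow> real) \<Rightarrow> bool" where
  "has_jump_rates S p r \<longleftrightarrow>
     (\<forall>x\<in>S. \<forall>y\<in>S. ((\<lambda>t. p t x y) has_real_derivative generator S r x y) (at 0 within {0..}))"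

text \<open>The last clause is the time-homogeneous Markov property with transition function \<open>p\<close>.
  It is multiplied out, so that conditioning on null events imposes nothing. The initial
  law is left free, and no regularity of the paths is required.\<close>

definition ctmc ::
  "'a measure \<Rightarrow> 's set \<Rightarrow> ('s \<Rightarrow> 's \<Rightarrow> real) \<Rightarrow> (real \<Rightarrow> 'a \<Rightarrow> 's) \<Rightarrow> bool" where
  "ctmc M S r X \<longleftrightarrow>
     prob_space M \<and>
     (\<forall>t\<ge>0. X t \<in> measurable M (count_space S)) \<and>
     (\<exists>p. transition_function S p \<and> has_jump_rates S p r \<and>
        (\<forall>(k::nat) (t::nat \<Rightarrow> real) (x::nat \<Rightarrow> 's).
           0 \<le> t 0 \<and> (\<forall>i\<le>k. t i \<le> t (Suc i)) \<and> (\<forall>i\<le>Suc k. x i \<in> S) \<longrightarrow>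
           measure M {\<omega> \<in> space M. \<forall>i\<le>Suc k. X (t i) \<omega> = x i} =
           measure M {\<omega> \<in> space M. \<forall>i\<le>k. X (t i) \<omega> = x i} *
             p (t (Suc k) - t k) (x k) (x (Suc k))))"


section \<open>The stochastic order\<close>

text \<open>The order on laws; \<open>mono_on\<close> refers to the partial order of the state type.\<close>

definition stoch_le :: "'s::order measure \<Rightarrow> 's measure \<Rightarrow> bool" where
  "stoch_le \<mu> \<nu> \<longleftrightarrow>
     (\<forall>f :: 's \<Rightarrow> real. mono_on (space \<mu> \<union> space \<nu>) f \<and> integrable \<mu> f \<and> integrable \<nu> f \<longrightarrow>
        integral\<^sup>L \<mu> f \<le> integral\<^sup>L \<nu> f)"


section \<open>The chain of class occupancies\<close>

definition num_classes :: "nat \<Rightarrow> nat \<Rightarrow> nat" where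
  "num_classes n d = n choose d"

text \<open>\<open>C i\<close> is the set of servers of class \<open>i\<close>.\<close>

definition class_indexing :: "nat \<Rightarrow> nat \<Rightarrow> (nat \<Rightarrow> nat set) \<Rightarrow> bool" where
  "class_indexing n d C \<longleftrightarrow>
     bij_betw C {1..num_classes n d} {A. A \<subseteq> {1..n} \<and> card A = d}"

definition classes_of_server :: "nat \<Rightarrow> nat \<Rightarrow> (nat \<Rightarrow> nat set) \<Rightarrow> nat \<Rightarrow> nat set" where
  "classes_of_server n d C j = {i \<in> {1..num_classes n d}. j \<in> C i}"

text \<open>Vectors in \<open>\<int>\<^sub>+\<^sup>m\<close> are functions that vanish outside the index set \<open>{1..m}\<close>. On them
  the pointwise order of functions is the componentwise order over \<open>{1..m}\<close>.\<close>

definition states :: "nat \<Rightarrow> nat \<Rightarrow> (nat \<Rightarrow> nat) set" where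
  "states n d = {x. \<forall>i. i \<notin> {1..num_classes n d} \<longrightarrow> x i = 0}"

definition server_load :: "nat \<Rightarrow> nat \<Rightarrow> (nat \<Rightarrow> nat set) \<Rightarrow> (nat \<Rightarrow> nat) \<Rightarrow> nat \<Rightarrow> nat" where
  "server_load n d C x j = (\<Sum>i\<in>classes_of_server n d C j. x i)"

definition arrival_rate :: "nat \<Rightarrow> nat \<Rightarrow> real \<Rightarrow> real" where
  "arrival_rate n d lam = real n * lam / real (num_classes n d)"

text \<open>If \<open>x i > 0\<close>, then all loads in the sum are positive; if \<open>x i = 0\<close>, then the rate is 0.\<close>

definition departure_rate ::
  "nat \<Rightarrow> nat \<Rightarrow> (nat \<Rightarrow> nat set) \<Rightarrow> nat \<Rightarrow> (nat \<Rightarrow> nat) \<Rightarrow> real" where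
  "departure_rate n d C i x = real (x i) * (\<Sum>j\<in>C i. 1 / real (server_load n d C x j))"

text \<open>The condition \<open>x = y(i := Suc (y i))\<close> says \<open>y = x - e\<^sub>i\<close> without truncated subtraction.
  From each state only finitely many jumps have a positive rate.\<close>

definition jump_rate ::
  "nat \<Rightarrow> nat \<Rightarrow> real \<Rightarrow> (nat \<Rightarrow> nat set) \<Rightarrow> (nat \<Rightarrow> nat) \<Rightarrow> (nat \<Rightarrow> nat) \<Rightarrow> real" where
  "jump_rate n d lam C x y =
     (\<Sum>i\<in>{1..num_classes n d}.
        (if y = x(i := Suc (x i)) then arrival_rate n d lam else 0) +
        (if x = y(i := Suc (y i)) then departure_rate n d C i x else 0))"

end

theory Submission imports Defs begin

text \<open>
  The total jump rates are bounded, by \<open>2 n\<close> for this chain, because every server that serves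
  anybody contributes exactly 1 to the total departure rate. Doubling the time step shows that
  \<open>P h = I + h Q + O(h\<^sup>2)\<close> uniformly in the state, although the derivative of the transition
  function is only given entrywise at 0. For small \<open>h\<close> the operator \<open>I + h Q\<close> does not
  increase \<open>sup {v x - v y | x \<le> y}\<close>: couple the jumps of the two copies and use that for
  \<open>x \<le> y\<close> and \<open>x i = y i\<close> the departure rate of class \<open>i\<close> is at least as large in \<open>x\<close>
  as in \<open>y\<close>. Iterating \<open>k\<close> times with step \<open>t / k\<close> costs an error \<open>O(1 / k)\<close>, so \<open>P t\<close>
  preserves bounded monotone functions. As 0 is the least state,
  \<open>P t v 0 = P (t - s) (P s v) 0 \<ge> P s v 0\<close>; truncation removes the boundedness of \<open>v\<close>.
\<close>

section \<open>Expectations under probability mass functions\<close>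

lemma integrable_pmf_bounded:
  fixes f :: "'s \<Rightarrow> real"
  assumes "\<And>x. \<bar>f x\<bar> \<le> B"
  shows "integrable (measure_pmf p) f"
  by (rule measure_pmf.integrable_const_bound[where B = B]) (use assms in auto)

lemma abs_expectation_pmf_le:
  fixes f :: "'s \<Rightarrow> real"
  assumes "\<And>x. \<bar>f x\<bar> \<le> B"
  shows "\<bar>measure_pmf.expectation p f\<bar> \<le> B"
proof -
  have int: "integrable (measure_pmf p) f"
    using assms by (rule integrable_pmf_bounded)
  have "\<bar>measure_pmf.expectation p f\<bar> \<le> measure_pmf.expectation p (\<lambda>x. \<bar>f x\<bar>)"
    by (rule integral_abs_bound)
  also have "\<dots> \<le> B"
    by (rule measure_pmf.integral_le_const) (use assms int in auto)
  finally show ?thesis .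
qed

text \<open>For nonnegative integrands this is the iterated \<open>nn_integral\<close> over
  \<open>bind_pmf\<close>. Adding \<open>B\<close> moves \<open>f\<close> into the range from 0 to
  \<open>2 * B\<close>, and linearity removes the shift again.\<close>

lemma expectation_bind_pmf:
  fixes f :: "'s \<Rightarrow> real"
  assumes bd: "\<And>x. \<bar>f x\<bar> \<le> B"
  shows "measure_pmf.expectation (bind_pmf p k) f =
    measure_pmf.expectation p (\<lambda>y. measure_pmf.expectation (k y) f)"
proof -
  define g where "g x = f x + B" for x
  have g0: "0 \<le> g x" for x
    using bd[of x] by (auto simp: g_def)
  have gB: "\<bar>g x\<bar> \<le> 2 * B" for x
    using bd[of x] by (auto simp: g_def)
  have E_nn: "ennreal (measure_pmf.expectation q g) = (\<integral>\<^sup>+x. g x \<partial>measure_pmf q)" for q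
    using integrable_pmf_bounded[of g, OF gB] g0 by (subst nn_integral_eq_integral) auto
  have E0: "0 \<le> measure_pmf.expectation q g" for q
    using g0 by (intro integral_nonneg_AE) auto
  have EB: "\<bar>measure_pmf.expectation q g\<bar> \<le> 2 * B" for q
    by (rule abs_expectation_pmf_le[OF gB])
  have E_shift: "measure_pmf.expectation q g = measure_pmf.expectation q f + B" for q
    unfolding g_def using integrable_pmf_bounded[of f, OF bd] by simp
  have "ennreal (measure_pmf.expectation (bind_pmf p k) g) =
      (\<integral>\<^sup>+y. \<integral>\<^sup>+x. g x \<partial>k y \<partial>measure_pmf p)"
    unfolding E_nn by simp
  also have "\<dots> = (\<integral>\<^sup>+y. measure_pmf.expectation (k y) g \<partial>measure_pmf p)"
    by (simp add: E_nn)
  also have "\<dots> = ennreal (measure_pmf.expectation p (\<lambda>y. measure_pmf.expectation (k y) g))"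
    by (rule nn_integral_eq_integral[OF integrable_pmf_bounded[OF EB]]) (simp add: E0)
  finally have "measure_pmf.expectation (bind_pmf p k) g =
      measure_pmf.expectation p (\<lambda>y. measure_pmf.expectation (k y) g)"
    by (subst (asm) ennreal_inj) (auto intro!: E0 integral_nonneg_AE)
  moreover have "integrable (measure_pmf p) (\<lambda>y. measure_pmf.expectation (k y) f)"
    by (rule integrable_pmf_bounded[OF abs_expectation_pmf_le[OF bd]])
  ultimately show ?thesis
    unfolding E_shift by simp
qed

text \<open>The error comes from the mass outside \<open>A\<close>, where \<open>w\<close> is at
  most \<open>B\<close> in absolute value. Later \<open>w\<close> is an increment
  \<open>v z - v x\<close>, and \<open>A\<close> is the start \<open>x\<close> alone or
  \<open>x\<close> with its jump targets.\<close>

lemma expectation_pmf_finite_approx: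
  fixes w :: "'s \<Rightarrow> real"
  assumes bd: "\<And>x. \<bar>w x\<bar> \<le> B" and A: "finite A"
  shows "\<bar>measure_pmf.expectation p w - (\<Sum>z\<in>A. pmf p z * w z)\<bar> \<le> B * (1 - (\<Sum>z\<in>A. pmf p z))"
proof -
  have "\<bar>w x * indicator A x\<bar> \<le> B" for x
    using bd[of x] by (auto simp: indicator_def)
  note int = integrable_pmf_bounded[of w, OF bd] integrable_pmf_bounded[of "\<lambda>x. w x * indicator A x", OF this]
  have "(\<Sum>z\<in>A. pmf p z * w z) = measure_pmf.expectation p (\<lambda>x. w x * indicator A x)"
    by (subst integral_measure_pmf_real[OF A]) (auto simp: indicator_def mult.commute intro!: sum.cong)
  then have "measure_pmf.expectation p w - (\<Sum>z\<in>A. pmf p z * w z) =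
      measure_pmf.expectation p (\<lambda>x. w x - w x * indicator A x)"
    using int by simp
  also have "\<bar>\<dots>\<bar> \<le> measure_pmf.expectation p (\<lambda>x. \<bar>w x - w x * indicator A x\<bar>)"
    by (rule integral_abs_bound)
  also have "\<dots> \<le> measure_pmf.expectation p (\<lambda>x. B * indicator (- A) x)"
  proof (rule integral_mono)
    show "integrable (measure_pmf p) (\<lambda>x. \<bar>w x - w x * indicator A x\<bar>)"
      using int by simp
    show "integrable (measure_pmf p) (\<lambda>x. B * indicator (- A) x)"
      by (rule integrable_pmf_bounded[where B = "\<bar>B\<bar>"]) (auto simp: indicator_def)
  qed (use bd in \<open>auto simp: indicator_def\<close>)
  also have "\<dots> = B * measure_pmf.prob p (- A)"
    by simp
  also have "measure_pmf.prob p (- A) = 1 - (\<Sum>z\<in>A. pmf p z)"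
    using measure_pmf.prob_compl[of A p] A by (simp add: measure_measure_pmf_finite Compl_eq_Diff_UNIV)
  finally show ?thesis .
qed

text \<open>The defect of \<open>e\<close> from \<open>h \<mapsto> h L\<close> at most doubles, up to a quadratic error, when \<open>h\<close> is
  doubled. Since it is \<open>o(h)\<close>, a pointwise limit thus yields an explicit bound.\<close>

lemma halving_bound:
  fixes e :: "real \<Rightarrow> real"
  assumes dbl: "\<And>h. 0 < h \<Longrightarrow> e (2 * h) \<le> 2 * e h + 2 * c * h\<^sup>2"
    and lim: "((\<lambda>h. e h / h) \<longlongrightarrow> L) (at_right 0)" and h: "0 < h"
  shows "e h \<le> h * L + c * h\<^sup>2"
proof -
  \<comment> \<open>The successive halvings cost \<open>c * h\<^sup>2\<close> times 1/2, 1/4, 1/8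
    and so on, in total \<open>1 - 1 / 2 ^ k\<close>.\<close>
  have iter: "e h \<le> 2 ^ k * e (h / 2 ^ k) + c * h\<^sup>2 * (1 - 1 / 2 ^ k)" for k
  proof (induction k)
    case (Suc k)
    have "e (h / 2 ^ k) \<le> 2 * e (h / 2 ^ Suc k) + 2 * c * (h / 2 ^ Suc k)\<^sup>2"
      using dbl[of "h / 2 ^ Suc k"] h by simp
    then have "2 ^ k * e (h / 2 ^ k) \<le> 2 ^ k * (2 * e (h / 2 ^ Suc k) + 2 * c * (h / 2 ^ Suc k)\<^sup>2)"
      by (intro mult_left_mono) auto
    also have "\<dots> = 2 ^ Suc k * e (h / 2 ^ Suc k) + c * h\<^sup>2 * (1 / 2 ^ k - 1 / 2 ^ Suc k)"
      by (simp add: field_simps power2_eq_square)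
    finally show ?case
      using Suc.IH unfolding right_diff_distrib by linarith
  qed simp
  have to0: "filterlim (\<lambda>k. h / 2 ^ k) (at_right 0) sequentially"
  proof (rule tendsto_imp_filterlim_at_right)
    show "(\<lambda>k. h / 2 ^ k) \<longlonglongrightarrow> 0"
      using LIMSEQ_divide_realpow_zero[of 2 h] by simp
  qed (use h in auto)
  have half: "(\<lambda>k. 1 / 2 ^ k :: real) \<longlonglongrightarrow> 0"
    using LIMSEQ_divide_realpow_zero[of 2 1] by simp
  have "(\<lambda>k. h * (e (h / 2 ^ k) / (h / 2 ^ k)) + c * h\<^sup>2 * (1 - 1 / 2 ^ k))
      \<longlonglongrightarrow> h * L + c * h\<^sup>2 * (1 - 0)"
    by (intro tendsto_intros filterlim_compose[OF lim to0] half)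
  then have lim': "(\<lambda>k. 2 ^ k * e (h / 2 ^ k) + c * h\<^sup>2 * (1 - 1 / 2 ^ k)) \<longlonglongrightarrow> h * L + c * h\<^sup>2"
    using h by (simp add: field_simps)
  show ?thesis
    by (rule LIMSEQ_le_const[OF lim']) (use iter in auto)
qed

section \<open>Semigroups with bounded jump rates\<close>

text \<open>Only entrywise derivatives at 0 are assumed. By \<open>deriv_stay\<close> the exit rate
  from \<open>x\<close> is the sum of the rates into \<open>F x\<close>, so at first order no mass
  goes elsewhere. Outside \<open>S\<close> the kernels stand still, so uniform bounds can hold on
  the whole type.\<close>

locale bounded_jump_semigroup =
  fixes S :: "'s set" and K :: "real \<Rightarrow> 's \<Rightarrow> 's pmf"
    and r :: "'s \<Rightarrow> 's \<Rightarrow> real" and F :: "'s \<Rightarrow> 's set" and \<Lambda> :: real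
  assumes K_0: "K 0 x = return_pmf x"
    and K_add: "0 \<le> s \<Longrightarrow> 0 \<le> t \<Longrightarrow> K (s + t) x = bind_pmf (K s x) (K t)"
    and K_outside: "x \<notin> S \<Longrightarrow> K t x = return_pmf x"
    and set_K: "x \<in> S \<Longrightarrow> set_pmf (K t x) \<subseteq> S"
    and finite_F: "finite (F x)"
    and not_in_F: "x \<notin> F x"
    and deriv_jump: "x \<in> S \<Longrightarrow> y \<in> F x \<Longrightarrow>
      ((\<lambda>t. pmf (K t x) y) has_real_derivative r x y) (at 0 within {0..})"
    and deriv_stay: "x \<in> S \<Longrightarrow>
      ((\<lambda>t. pmf (K t x) x) has_real_derivative - (\<Sum>y\<in>F x. r x y)) (at 0 within {0..})"
    and rate_bound: "x \<in> S \<Longrightarrow> (\<Sum>y\<in>F x. r x y) \<le> \<Lambda>"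
    and rate_bound_nonneg: "0 \<le> \<Lambda>"
begin

definition P :: "real \<Rightarrow> ('s \<Rightarrow> real) \<Rightarrow> 's \<Rightarrow> real" where
  "P t v x = measure_pmf.expectation (K t x) v"

definition Q :: "('s \<Rightarrow> real) \<Rightarrow> 's \<Rightarrow> real" where
  "Q v x = (\<Sum>z\<in>F x. r x z * (v z - v x))"

lemma P_0: "P 0 v x = v x"
  by (simp add: P_def K_0)

lemma abs_P_le: "(\<And>x. \<bar>v x\<bar> \<le> B) \<Longrightarrow> \<bar>P t v x\<bar> \<le> B"
  unfolding P_def by (rule abs_expectation_pmf_le)

lemma P_add:
  assumes "\<And>x. \<bar>v x\<bar> \<le> B" "0 \<le> s" "0 \<le> t"
  shows "P (s + t) v x = P s (P t v) x"
  unfolding P_def using expectation_bind_pmf[of v, OF assms(1)] K_add[OF assms(2,3)] by simp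

lemma P_diff:
  assumes "\<And>x. \<bar>v x\<bar> \<le> B" "\<And>x. \<bar>w x\<bar> \<le> B'"
  shows "P t (\<lambda>z. v z - w z) x = P t v x - P t w x"
  unfolding P_def
  by (rule Bochner_Integration.integral_diff;
      rule integrable_pmf_bounded, fact)

lemma P_const_diff:
  assumes "\<And>x. \<bar>v x\<bar> \<le> B"
  shows "measure_pmf.expectation (K t x) (\<lambda>z. v z - v x) = P t v x - v x"
  unfolding P_def using integrable_pmf_bounded[of v, OF assms] by simp

lemma abs_increment_le:
  fixes v :: "'s \<Rightarrow> real"
  assumes "\<And>x. \<bar>v x\<bar> \<le> B"
  shows "\<bar>v z - v x\<bar> \<le> 2 * B"
  using assms[of z] assms[of x] by linarith

section \<open>First-order behaviour of the semigroup at time 0\<close>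

lemma quotient_jump:
  assumes "x \<in> S" "y \<in> F x"
  shows "((\<lambda>h. pmf (K h x) y / h) \<longlongrightarrow> r x y) (at_right 0)"
proof -
  have "x \<noteq> y"
    using assms(2) not_in_F[of x] by auto
  then show ?thesis
    using deriv_jump[OF assms] by (simp add: has_field_derivative_iff at_within_Ici_at_right K_0)
qed

lemma quotient_stay:
  assumes "x \<in> S"
  shows "((\<lambda>h. (1 - pmf (K h x) x) / h) \<longlongrightarrow> (\<Sum>y\<in>F x. r x y)) (at_right 0)"
proof -
  have "((\<lambda>h. (pmf (K h x) x - 1) / h) \<longlongrightarrow> - (\<Sum>y\<in>F x. r x y)) (at_right 0)"
    using deriv_stay[OF assms]
    by (simp add: has_field_derivative_iff at_within_Ici_at_right K_0)
  from tendsto_minus[OF this] show ?thesis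
    by (simp add: minus_divide_left)
qed

text \<open>If \<open>a\<close> is the probability to be at \<open>x\<close> at time
  \<open>h\<close>, then that at time \<open>2 * h\<close> is at least \<open>a * a\<close>, and
  \<open>1 - a * a\<close> is at most \<open>2 * (1 - a)\<close>. So \<open>halving_bound\<close>
  applies with \<open>c = 0\<close> and turns the derivative at 0 into a bound for every
  \<open>h\<close>.\<close>

lemma leave_prob_le:
  assumes "0 \<le> h"
  shows "1 - pmf (K h x) x \<le> \<Lambda> * h"
proof (cases "x \<in> S \<and> 0 < h")
  case True
  then have x: "x \<in> S" and h: "0 < h" by auto
  have "1 - pmf (K h x) x \<le> h * (\<Sum>y\<in>F x. r x y) + 0 * h\<^sup>2"
  proof (rule halving_bound[OF _ quotient_stay[OF x] h])
    fix h :: real assume h: "0 < h"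
    define a where "a = pmf (K h x) x"
    have "pmf (K (2 * h) x) x = measure_pmf.expectation (K h x) (\<lambda>y. pmf (K h y) x)"
      using K_add[of h h x] h by (simp add: pmf_bind)
    also have "\<dots> \<ge> measure_pmf.expectation (K h x) (\<lambda>y. a * indicator {x} y)"
      by (rule integral_mono)
        (auto intro!: integrable_pmf_bounded[where B = 1]
          simp: a_def indicator_def pmf_le_1 abs_mult)
    moreover have "measure_pmf.expectation (K h x) (\<lambda>y. a * indicator {x} y) = a * a"
      by (simp add: a_def measure_pmf_single)
    ultimately have "a * a \<le> pmf (K (2 * h) x) x" by metis
    moreover have "1 - a * a \<le> 2 * (1 - a)"
      using zero_le_power2[of "1 - a"] by (simp add: power2_eq_square algebra_simps)
    ultimately show "1 - pmf (K (2 * h) x) x \<le> 2 * (1 - pmf (K h x) x) + 2 * 0 * h\<^sup>2"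
      unfolding a_def[symmetric] by simp
  qed
  also have "\<dots> \<le> \<Lambda> * h"
    using mult_left_mono[OF rate_bound[OF x], of h] h by (simp add: mult.commute)
  finally show ?thesis .
next
  case False
  then have "K h x = return_pmf x"
    using assms K_outside[of x h] K_0[of x] by (cases "h = 0") auto
  then show ?thesis
    using assms rate_bound_nonneg by simp
qed

text \<open>The increment \<open>v z - v x\<close> vanishes at \<open>z = x\<close> and is at most
  \<open>2 * B\<close> elsewhere, where the mass is at most \<open>\<Lambda> * h\<close>.\<close>

lemma P_near_id:
  assumes bd: "\<And>x. \<bar>v x\<bar> \<le> B" and "0 \<le> h"
  shows "\<bar>P h v x - v x\<bar> \<le> 2 * B * (\<Lambda> * h)"
proof -
  have "0 \<le> B"
    using bd[of x] by linarith
  have "\<bar>P h v x - v x\<bar> \<le> 2 * B * (1 - pmf (K h x) x)"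
    using expectation_pmf_finite_approx[of "\<lambda>z. v z - v x" "2 * B" "{x}" "K h x",
        OF abs_increment_le[of v, OF bd]]
    unfolding P_const_diff[of v, OF bd] by simp
  also have "\<dots> \<le> 2 * B * (\<Lambda> * h)"
    using leave_prob_le[OF assms(2), of x] \<open>0 \<le> B\<close> by (intro mult_left_mono) auto
  finally show ?thesis .
qed

text \<open>On the finite set \<open>F x\<close> the limit can be taken term by term. The mass
  outside \<open>insert x (F x)\<close> is o(h), since the rates into \<open>F x\<close> exhaust the
  exit rate, and \<open>v\<close> is bounded.\<close>

lemma quotient_P:
  assumes bd: "\<And>x. \<bar>v x\<bar> \<le> B" and x: "x \<in> S"
  shows "((\<lambda>h. (P h v x - v x) / h) \<longlongrightarrow> Q v x) (at_right 0)"
proof -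
  define G where "G h = (\<Sum>z\<in>F x. pmf (K h x) z / h * (v z - v x))" for h
  \<comment> \<open>\<open>R h\<close> is \<open>2 * B / h\<close> times the probability to be
    outside \<open>insert x (F x)\<close>; it bounds the error of \<open>G h\<close>.\<close>
  define R where "R h = 2 * B * ((1 - pmf (K h x) x) / h - (\<Sum>z\<in>F x. pmf (K h x) z / h))" for h
  have "(R \<longlongrightarrow> 2 * B * ((\<Sum>y\<in>F x. r x y) - (\<Sum>y\<in>F x. r x y))) (at_right 0)"
    unfolding R_def by (intro tendsto_intros quotient_jump quotient_stay x)
  then have R: "(R \<longlongrightarrow> 0) (at_right 0)" by simp
  have G: "(G \<longlongrightarrow> Q v x) (at_right 0)"
    unfolding G_def Q_def by (intro tendsto_intros quotient_jump x)
  have "\<bar>(P h v x - v x) / h - G h\<bar> \<le> R h" if h: "0 < h" for h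
  proof -
    have "\<bar>P h v x - v x - (\<Sum>z\<in>F x. pmf (K h x) z * (v z - v x))\<bar>
        \<le> 2 * B * (1 - pmf (K h x) x - (\<Sum>z\<in>F x. pmf (K h x) z))"
      using expectation_pmf_finite_approx[of "\<lambda>z. v z - v x" "2 * B" "insert x (F x)" "K h x",
          OF abs_increment_le[of v, OF bd]] finite_F[of x] not_in_F[of x]
      unfolding P_const_diff[of v, OF bd] by (simp add: algebra_simps)
    from divide_right_mono[OF this, of h] h have
      "\<bar>(P h v x - v x - (\<Sum>z\<in>F x. pmf (K h x) z * (v z - v x))) / h\<bar>
        \<le> 2 * B * (1 - pmf (K h x) x - (\<Sum>z\<in>F x. pmf (K h x) z)) / h"
      by simp
    moreover have "(P h v x - v x - (\<Sum>z\<in>F x. pmf (K h x) z * (v z - v x))) / h =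
        (P h v x - v x) / h - G h"
      unfolding G_def by (simp add: diff_divide_distrib sum_divide_distrib)
    moreover have "2 * B * (1 - pmf (K h x) x - (\<Sum>z\<in>F x. pmf (K h x) z)) / h = R h"
      unfolding R_def sum_divide_distrib[symmetric] diff_divide_distrib[symmetric] by simp
    ultimately show ?thesis by simp
  qed
  then have "((\<lambda>h. (P h v x - v x) / h - G h) \<longlongrightarrow> 0) (at_right 0)"
    by (intro tendsto_rabs_zero_cancel[OF tendsto_sandwich[OF _ _ tendsto_const R]])
      (auto intro: eventually_at_right_less eventually_mono[OF eventually_at_right_less[of 0]])
  from tendsto_add[OF this G] show ?thesis by simp
qed

text \<open>With \<open>w = P h v - v\<close>, the error at \<open>2 * h\<close> is
  \<open>P h w - w\<close> plus twice the error at \<open>h\<close>. Two uses of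
  \<open>P_near_id\<close> bound the first term by
  \<open>4 * B * \<Lambda>\<^sup>2 * h\<^sup>2\<close>. As the error is o(h) at each state,
  \<open>halving_bound\<close> with \<open>L = 0\<close> gives a constant that does not depend on
  \<open>x\<close>.\<close>

lemma P_euler_step:
  assumes bd: "\<And>x. \<bar>v x\<bar> \<le> B" and x: "x \<in> S" and h: "0 < h"
  shows "\<bar>P h v x - v x - h * Q v x\<bar> \<le> 2 * B * \<Lambda>\<^sup>2 * h\<^sup>2"
proof -
  define e where "e h = \<bar>P h v x - v x - h * Q v x\<bar>" for h
  have "e h \<le> h * 0 + 2 * B * \<Lambda>\<^sup>2 * h\<^sup>2"
  proof (rule halving_bound[OF _ _ h])
    fix h :: real assume h: "0 < h"
    define w where "w z = P h v z - v z" for z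
    have wB: "\<bar>w z\<bar> \<le> 2 * B * (\<Lambda> * h)" for z
      unfolding w_def using P_near_id[of v, OF bd] h by simp
    have "P (2 * h) v x = P h (P h v) x"
      using P_add[of v, OF bd, of h h x] h by simp
    then have "P (2 * h) v x - v x - 2 * h * Q v x = (P h w x - w x) + 2 * (P h v x - v x - h * Q v x)"
      unfolding w_def P_diff[of "P h v", OF abs_P_le[of v, OF bd] bd] by simp
    moreover have "\<bar>P h w x - w x\<bar> \<le> 2 * (2 * B * (\<Lambda> * h)) * (\<Lambda> * h)"
      using P_near_id[of w, OF wB] h by simp
    moreover have "\<bar>a + 2 * b\<bar> \<le> \<bar>a\<bar> + 2 * \<bar>b\<bar>" for a b :: real
      by linarith
    ultimately have "e (2 * h) \<le> 2 * (2 * B * (\<Lambda> * h)) * (\<Lambda> * h) + 2 * e h"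
      unfolding e_def by (metis add_right_mono order_trans)
    then show "e (2 * h) \<le> 2 * e h + 2 * (2 * B * \<Lambda>\<^sup>2) * h\<^sup>2"
      by (simp add: power2_eq_square algebra_simps)
  next
    have "((\<lambda>h. (P h v x - v x) / h - Q v x) \<longlongrightarrow> Q v x - Q v x) (at_right 0)"
      by (intro tendsto_intros quotient_P[OF bd x])
    then have "((\<lambda>h. \<bar>(P h v x - v x) / h - Q v x\<bar>) \<longlongrightarrow> 0) (at_right 0)"
      using tendsto_rabs_zero by fastforce
    then show "((\<lambda>h. e h / h) \<longlongrightarrow> 0) (at_right 0)"
    proof (rule Lim_transform_eventually)
      show "\<forall>\<^sub>F h in at_right 0. \<bar>(P h v x - v x) / h - Q v x\<bar> = e h / h"
        using eventually_at_right_less[of 0]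
      proof eventually_elim
        case (elim h)
        then have "(P h v x - v x) / h - Q v x = (P h v x - v x - h * Q v x) / h"
          by (simp add: field_simps)
        then show ?case
          using elim by (simp add: e_def)
      qed
    qed
  qed
  then show ?thesis
    by (simp add: e_def)
qed

end

text \<open>The condition \<open>euler_mono\<close> is about a defect \<open>\<delta>\<close> and
  not just about monotone \<open>v\<close>: the iterates \<open>P (k * h) v\<close> are known to be
  monotone only up to an error, which an Euler step must not amplify.\<close>

locale monotone_jump_semigroup = bounded_jump_semigroup S K r F \<Lambda>
  for S :: "'s::order set" and K r F \<Lambda> +
  fixes h0 :: real
  assumes h0: "0 < h0"
    and euler_mono: "\<lbrakk>0 < h; h \<le> h0; x \<in> S; y \<in> S; x \<le> y;
      \<And>x y. x \<in> S \<Longrightarrow> y \<in> S \<Longrightarrow> x \<le> y \<Longrightarrow> v x - v y \<le> \<delta>\<rbrakk> \<Longrightarrow>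
      (v x + h * Q v x) - (v y + h * Q v y) \<le> \<delta>"
begin

lemma P_mono:
  assumes bd: "\<And>x. \<bar>v x\<bar> \<le> B" and mono: "mono_on S v" and t: "0 \<le> t"
  shows "mono_on S (P t v)"
proof (rule mono_onI)
  fix x y assume xy: "x \<in> S" "y \<in> S" "x \<le> y"
  \<comment> \<open>Each step adds one Euler error
    \<open>2 * B * \<Lambda>\<^sup>2 * h\<^sup>2\<close> for \<open>x\<close> and one for
    \<open>y\<close>.\<close>
  define c where "c = 4 * B * \<Lambda>\<^sup>2"
  have iter: "P (real k * h) v x - P (real k * h) v y \<le> real k * (c * h\<^sup>2)"
    if h: "0 < h" "h \<le> h0" and "x \<in> S" "y \<in> S" "x \<le> y" for h k x y
    using that(3-)
  proof (induction k arbitrary: x y)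
    case 0
    then show ?case
      using mono by (simp add: P_0 mono_onD)
  next
    case (Suc k)
    define u where "u = P (real k * h) v"
    have uB: "\<bar>u z\<bar> \<le> B" for z
      unfolding u_def by (rule abs_P_le[OF bd])
    have step: "P (real (Suc k) * h) v z = P h u z" for z
      using P_add[of v, OF bd, of h "real k * h" z] h unfolding u_def by (simp add: algebra_simps)
    have "(u x + h * Q u x) - (u y + h * Q u y) \<le> real k * (c * h\<^sup>2)"
      by (rule euler_mono[OF h Suc.prems]) (use Suc.IH in \<open>simp add: u_def\<close>)
    moreover have "\<bar>P h u x - u x - h * Q u x\<bar> \<le> 2 * B * \<Lambda>\<^sup>2 * h\<^sup>2"
      "\<bar>P h u y - u y - h * Q u y\<bar> \<le> 2 * B * \<Lambda>\<^sup>2 * h\<^sup>2"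
      using P_euler_step[of u, OF uB] Suc.prems h by auto
    ultimately have "P h u x - P h u y \<le> real k * (c * h\<^sup>2) + 4 * B * \<Lambda>\<^sup>2 * h\<^sup>2"
      unfolding abs_le_iff by linarith
    then show ?case
      unfolding step c_def by (simp add: algebra_simps)
  qed
  show "P t v x \<le> P t v y"
  proof (cases "t = 0")
    case True
    then show ?thesis
      using mono xy by (simp add: P_0 mono_onD)
  next
    case False
    \<comment> \<open>This is the accumulated error of \<open>Suc k\<close> steps of length
      \<open>t / Suc k\<close>; the successor avoids a division by 0.\<close>
    have lim: "(\<lambda>k. c * t\<^sup>2 / real (Suc k)) \<longlonglongrightarrow> 0"
      by (intro LIMSEQ_Suc lim_const_over_n)
    have "eventually (\<lambda>k. t / real (Suc k) < h0) sequentially"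
      using LIMSEQ_Suc[OF lim_const_over_n[of t]] h0 by (rule order_tendstoD)
    then have "eventually (\<lambda>k. P t v x - P t v y \<le> c * t\<^sup>2 / real (Suc k)) sequentially"
    proof eventually_elim
      case (elim k)
      have "P t v x - P t v y \<le> real (Suc k) * (c * (t / real (Suc k))\<^sup>2)"
        using iter[of "t / real (Suc k)" x y "Suc k"] elim t False xy by simp
      also have "\<dots> = c * t\<^sup>2 / real (Suc k)"
        by (simp add: power2_eq_square del: of_nat_Suc)
      finally show ?case .
    qed
    then have "P t v x - P t v y \<le> 0"
      by (intro tendsto_lowerbound[OF lim]) auto
    then show ?thesis by simp
  qed
qed

section \<open>Monotonicity in time from the least state\<close>

lemma expectation_from_bot_mono_bounded:
  fixes v :: "'s \<Rightarrow> real"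
  assumes bd: "\<And>x. \<bar>v x\<bar> \<le> B" and mono: "mono_on S v"
    and x0: "x0 \<in> S" "\<And>x. x \<in> S \<Longrightarrow> x0 \<le> x" and st: "0 \<le> s" "s \<le> t"
  shows "measure_pmf.expectation (K s x0) v \<le> measure_pmf.expectation (K t x0) v"
proof -
  \<comment> \<open>The surplus time \<open>t - s\<close> is run first. All states that it can reach
    lie above \<open>x0\<close>, and \<open>P s v\<close> is monotone.\<close>
  have "P s v x0 \<le> P (t - s) (P s v) x0"
    unfolding P_def[of "t - s"]
  proof (rule measure_pmf.integral_ge_const)
    show "integrable (measure_pmf (K (t - s) x0)) (P s v)"
      by (rule integrable_pmf_bounded[OF abs_P_le[OF bd]])
    show "AE z in measure_pmf (K (t - s) x0). P s v x0 \<le> P s v z"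
      using set_K[OF x0(1)] mono_onD[OF P_mono[OF bd mono st(1)]] x0
      unfolding AE_measure_pmf_iff by blast
  qed
  also have "\<dots> = P t v x0"
    using P_add[of v, OF bd, of "t - s" s x0] st by simp
  finally show ?thesis
    by (simp add: P_def)
qed

text \<open>Integrability at time \<open>s\<close> gives dominated convergence of the truncations;
  integrability at time \<open>t\<close> lets the untruncated expectation bound all of them.\<close>

lemma expectation_from_bot_mono:
  fixes f :: "'s \<Rightarrow> real"
  assumes mono: "mono_on S f"
    and int: "integrable (measure_pmf (K s x0)) f" "integrable (measure_pmf (K t x0)) f"
    and x0: "x0 \<in> S" "\<And>x. x \<in> S \<Longrightarrow> x0 \<le> x" and st: "0 \<le> s" "s \<le> t"
  shows "measure_pmf.expectation (K s x0) f \<le> measure_pmf.expectation (K t x0) f"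
proof -
  \<comment> \<open>On \<open>S\<close> the difference \<open>f x - f x0\<close> is nonnegative, so
    only the cap \<open>N\<close> cuts there; \<open>max 0\<close> keeps \<open>g N\<close> bounded
    on the rest of the type.\<close>
  define g where "g N x = max 0 (min (f x - f x0) (real N))" for N x
  have gN: "\<bar>g N x\<bar> \<le> real N" for N x
    by (auto simp: g_def)
  have ge: "f x0 \<le> f x" if "x \<in> S" for x
    using mono_onD[OF mono] x0 that by blast
  have gf: "g N x \<le> f x - f x0" "0 \<le> g N x" if "x \<in> S" for N x
    using ge[OF that] by (auto simp: g_def)
  have g_mono: "mono_on S (g N)" for N
    by (rule mono_onI) (auto simp: g_def dest: mono_onD[OF mono])
  have AE_S: "AE x in measure_pmf (K u x0). x \<in> S" for u
    using set_K[OF x0(1)] by (auto simp: AE_measure_pmf_iff)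
  have lim: "(\<lambda>N. measure_pmf.expectation (K s x0) (g N))
      \<longlonglongrightarrow> measure_pmf.expectation (K s x0) (\<lambda>x. f x - f x0)"
  proof (rule integral_dominated_convergence[where w = "\<lambda>x. f x - f x0"])
    show "integrable (measure_pmf (K s x0)) (\<lambda>x. f x - f x0)"
      using int by simp
    show "AE x in measure_pmf (K s x0). (\<lambda>N. g N x) \<longlonglongrightarrow> f x - f x0"
      using AE_S
    proof eventually_elim
      case (elim x)
      have "eventually (\<lambda>N. g N x = f x - f x0) sequentially"
        using eventually_ge_at_top[of "nat \<lceil>f x - f x0\<rceil>"]
        by eventually_elim (use ge[OF elim] in \<open>auto simp: g_def\<close>)
      then show ?case
        by (rule tendsto_eventually)
    qed
    show "AE x in measure_pmf (K s x0). norm (g N x) \<le> f x - f x0" for N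
      using AE_S by eventually_elim (use gf in auto)
  qed auto
  have "measure_pmf.expectation (K s x0) (g N) \<le> measure_pmf.expectation (K t x0) (\<lambda>x. f x - f x0)" for N
  proof -
    have "measure_pmf.expectation (K s x0) (g N) \<le> measure_pmf.expectation (K t x0) (g N)"
      by (rule expectation_from_bot_mono_bounded[OF gN g_mono x0 st])
    also have "\<dots> \<le> measure_pmf.expectation (K t x0) (\<lambda>x. f x - f x0)"
    proof (rule integral_mono_AE)
      show "integrable (measure_pmf (K t x0)) (g N)"
        by (rule integrable_pmf_bounded[OF gN])
      show "AE x in measure_pmf (K t x0). g N x \<le> f x - f x0"
        using AE_S by eventually_elim (use gf in auto)
    qed (use int in simp)
    finally show ?thesis .
  qed
  then have "measure_pmf.expectation (K s x0) (\<lambda>x. f x - f x0) \<le>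
      measure_pmf.expectation (K t x0) (\<lambda>x. f x - f x0)"
    by (intro LIMSEQ_le_const2[OF lim]) auto
  then show ?thesis
    using int by simp
qed

end

section \<open>Laws of a Markov chain\<close>

text \<open>This replaces unordered sums by expectations and \<open>bind_pmf\<close>. Point masses
  serve as defaults outside \<open>S\<close> and at negative times, so that \<open>K t\<close> is a
  kernel on the whole type.\<close>

lemma transition_function_pmf:
  assumes "transition_function S p"
  obtains K where "\<And>x. K 0 x = return_pmf x"
    "\<And>s t x. 0 \<le> s \<Longrightarrow> 0 \<le> t \<Longrightarrow> K (s + t) x = bind_pmf (K s x) (K t)"
    "\<And>t x. x \<notin> S \<Longrightarrow> K t x = return_pmf x"
    "\<And>t x. x \<in> S \<Longrightarrow> set_pmf (K t x) \<subseteq> S"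
    "\<And>t x y. 0 \<le> t \<Longrightarrow> x \<in> S \<Longrightarrow> y \<in> S \<Longrightarrow> pmf (K t x) y = p t x y"
proof -
  \<comment> \<open>The values of \<open>p\<close> outside \<open>S\<close> are unconstrained;
    cutting them off gives total mass 1 on the type.\<close>
  define q where "q t x y = (if y \<in> S then p t x y else 0)" for t x y
  define K where "K t x = (if x \<in> S \<and> 0 \<le> t then embed_pmf (q t x) else return_pmf x)" for t x
  have p0: "0 \<le> p t x y" if "0 \<le> t" "x \<in> S" "y \<in> S" for t x y
    using assms that unfolding transition_function_def by blast
  have pmf_embed: "pmf (embed_pmf (q t x)) y = q t x y" if t: "0 \<le> t" and x: "x \<in> S" for t x y
  proof (rule pmf_embed_pmf)
    show q0: "0 \<le> q t x z" for z
      using p0[OF t x] by (simp add: q_def)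
    have "(p t x has_sum 1) S"
      using assms t x unfolding transition_function_def by blast
    then have sum: "(q t x has_sum 1) UNIV"
      by (subst has_sum_cong_neutral[where T = S and g = "p t x"]) (auto simp: q_def)
    \<comment> \<open>Absolute summability links \<open>has_sum\<close> to the integral over the
      counting measure.\<close>
    then have "(\<lambda>z. norm (q t x z)) summable_on UNIV"
      using q0 by (auto simp: summable_on_def)
    then have abs: "Infinite_Set_Sum.abs_summable_on (q t x) UNIV"
      using abs_summable_equivalent by blast
    then show "(\<integral>\<^sup>+z. ennreal (q t x z) \<partial>count_space UNIV) = 1"
      using sum q0 by (simp add: nn_integral_conv_infsetsum infsetsum_infsum infsumI)
  qed
  have pmf_K: "pmf (K t x) y = q t x y" if "0 \<le> t" "x \<in> S" for t x y
    using pmf_embed[OF that] that by (simp add: K_def)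
  have set_K: "set_pmf (K t x) \<subseteq> S" if "x \<in> S" for t x
    using pmf_embed[of t x] that by (auto simp: K_def set_pmf_eq q_def indicator_def split: if_splits)
  show thesis
  proof (rule that[of K])
    show "K 0 x = return_pmf x" for x
    proof (cases "x \<in> S")
      case True
      have "p 0 x y = (if x = y then 1 else 0)" if "y \<in> S" for y
        using assms True that unfolding transition_function_def by blast
      then show ?thesis
        using True by (intro pmf_eqI) (auto simp: pmf_K q_def indicator_def)
    qed (simp add: K_def)
    show "K (s + t) x = bind_pmf (K s x) (K t)" if st: "0 \<le> s" "0 \<le> t" for s t x
    proof (cases "x \<in> S")
      case True
      show ?thesis
      proof (rule pmf_eqI)
        fix z
        have "pmf (bind_pmf (K s x) (K t)) z = infsetsum (\<lambda>y. pmf (K s x) y * pmf (K t y) z) UNIV"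
          by (simp add: pmf_bind pmf_expectation_eq_infsetsum)
        also have "\<dots> = infsum (\<lambda>y. pmf (K s x) y * pmf (K t y) z) UNIV"
        proof (rule infsetsum_infsum)
          show "Infinite_Set_Sum.abs_summable_on (\<lambda>y. pmf (K s x) y * pmf (K t y) z) UNIV"
            by (rule abs_summable_on_comparison_test'[OF pmf_abs_summable[of "K s x"]])
              (simp add: pmf_le_1 mult_left_le)
        qed
        also have "\<dots> = infsum (\<lambda>y. q s x y * q t y z) S"
          using st True by (intro infsum_cong_neutral) (auto simp: pmf_K q_def)
        also have "\<dots> = q (s + t) x z"
        proof (cases "z \<in> S")
          case z: True
          then have "((\<lambda>y. p s x y * p t y z) has_sum p (s + t) x z) S"
            using assms st True unfolding transition_function_def by blast
          then have "infsum (\<lambda>y. p s x y * p t y z) S = p (s + t) x z"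
            by (rule infsumI)
          then show ?thesis
            using z by (simp add: q_def cong: infsum_cong)
        qed (simp add: q_def)
        finally show "pmf (K (s + t) x) z = pmf (bind_pmf (K s x) (K t)) z"
          using st True by (simp add: pmf_K)
      qed
    next
      case False
      then show ?thesis
        by (simp add: K_def bind_return_pmf)
    qed
  qed (use set_K pmf_K in \<open>auto simp: K_def q_def\<close>)
qed

lemma ctmc_law:
  assumes chain: "ctmc M S r X" and start: "AE \<omega> in M. X 0 \<omega> = x" and x: "x \<in> S"
  obtains p where "transition_function S p" "has_jump_rates S p r"
    "\<And>t y. 0 \<le> t \<Longrightarrow> y \<in> S \<Longrightarrow> measure M {\<omega> \<in> space M. X t \<omega> = y} = p t x y"
proof -
  interpret prob_space M
    using chain by (simp add: ctmc_def)
  have meas: "X t \<in> measurable M (count_space S)" if "0 \<le> t" for t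
    using chain that by (simp add: ctmc_def)
  have sets: "{\<omega> \<in> space M. X t \<omega> = y} \<in> events" if "0 \<le> t" for t y
  proof -
    have "X t -` ({y} \<inter> S) \<inter> space M \<in> events"
      by (rule measurable_sets[OF meas[OF that]]) auto
    also have "X t -` ({y} \<inter> S) \<inter> space M = {\<omega> \<in> space M. X t \<omega> = y}"
      using measurable_space[OF meas[OF that]] by auto
    finally show ?thesis .
  qed
  obtain p where p: "transition_function S p" "has_jump_rates S p r"
    and markov: "\<And>(k::nat) (t::nat \<Rightarrow> real) x. 0 \<le> t 0 \<and> (\<forall>i\<le>k. t i \<le> t (Suc i)) \<and>
      (\<forall>i\<le>Suc k. x i \<in> S) \<Longrightarrow>
      measure M {\<omega> \<in> space M. \<forall>i\<le>Suc k. X (t i) \<omega> = x i} =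
      measure M {\<omega> \<in> space M. \<forall>i\<le>k. X (t i) \<omega> = x i} * p (t (Suc k) - t k) (x k) (x (Suc k))"
    using chain unfolding ctmc_def by blast
  have all_le_1: "(\<forall>i\<le>Suc 0. Pr i) \<longleftrightarrow> Pr 0 \<and> Pr (Suc 0)" for Pr
    by (metis le_Suc_eq le_zero_eq)
  have "measure M {\<omega> \<in> space M. X t \<omega> = y} = p t x y" if t: "0 \<le> t" and y: "y \<in> S" for t y
  proof -
    have "measure M {\<omega> \<in> space M. X 0 \<omega> = x \<and> X t \<omega> = y} = measure M {\<omega> \<in> space M. X 0 \<omega> = x} * p t x y"
      using markov[of "\<lambda>i. if i = 0 then 0 else t" 0 "\<lambda>i. if i = 0 then x else y"] t x y
      unfolding all_le_1 by simp
    moreover have "measure M {\<omega> \<in> space M. X 0 \<omega> = x} = 1"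
      using start sets[of 0 x] by (subst prob_eq_1) (auto elim: AE_mp)
    moreover have "{\<omega> \<in> space M. X 0 \<omega> = x \<and> X t \<omega> = y} =
        {\<omega> \<in> space M. X 0 \<omega> = x} \<inter> {\<omega> \<in> space M. X t \<omega> = y}"
      by auto
    then have "measure M {\<omega> \<in> space M. X 0 \<omega> = x \<and> X t \<omega> = y} = measure M {\<omega> \<in> space M. X t \<omega> = y}"
      using start sets[of 0 x] sets[OF t, of y]
      by (intro finite_measure_eq_AE) auto
    ultimately show ?thesis by simp
  qed
  with p show thesis
    by (rule that)
qed

lemma distr_eq_pmf:
  assumes "prob_space M" and meas: "Y \<in> measurable M (count_space S)" and S: "countable S"
    and q: "set_pmf q \<subseteq> S"
    and law: "\<And>y. y \<in> S \<Longrightarrow> measure M {\<omega> \<in> space M. Y \<omega> = y} = pmf q y"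
  shows "distr M (count_space UNIV) Y = measure_pmf q"
proof -
  interpret prob_space M by fact
  have meas': "Y \<in> measurable M (count_space UNIV)"
    using meas by (rule measurable_compose) simp
  show ?thesis
  proof (rule measure_eqI_countable_AE[OF _ _ _ _ S])
    show "AE y in distr M (count_space UNIV) Y. y \<in> S"
      using measurable_space[OF meas] by (subst AE_distr_iff[OF meas']) auto
    show "AE y in measure_pmf q. y \<in> S"
      using q by (auto simp: AE_measure_pmf_iff)
    show "emeasure (distr M (count_space UNIV) Y) {y} = emeasure (measure_pmf q) {y}" if "y \<in> S" for y
    proof -
      have "Y -` {y} \<inter> space M = {\<omega> \<in> space M. Y \<omega> = y}"
        by auto
      then show ?thesis
        using law[OF that] by (simp add: emeasure_distr[OF meas'] emeasure_eq_measure emeasure_pmf_single)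
    qed
  qed auto
qed

text \<open>The theorem compares laws on \<open>count_space S\<close>, while a \<open>pmf\<close> is
  a measure on the whole type. Either integral is that of \<open>f\<close> composed with
  \<open>Y\<close> over \<open>M\<close>.\<close>

lemma distr_count_space_integral:
  fixes f :: "'s \<Rightarrow> real"
  assumes "Y \<in> measurable M (count_space S)"
  shows "integral\<^sup>L (distr M (count_space S) Y) f = integral\<^sup>L (distr M (count_space UNIV) Y) f"
    and "integrable (distr M (count_space S) Y) f \<longleftrightarrow> integrable (distr M (count_space UNIV) Y) f"
proof -
  have "Y \<in> measurable M (count_space UNIV)"
    using assms by (rule measurable_compose) simp
  then show "integral\<^sup>L (distr M (count_space S) Y) f = integral\<^sup>L (distr M (count_space UNIV) Y) f"
    "integrable (distr M (count_space S) Y) f \<longleftrightarrow> integrable (distr M (count_space UNIV) Y) f"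
    using assms by (simp_all add: integral_distr integrable_distr_eq)
qed

section \<open>The occupancy chain\<close>

lemma countable_states: "countable (states n d)"
proof (rule countable_subset)
  \<comment> \<open>Positions in a list start at 0. With \<open>Suc m\<close> entries,
    \<open>m\<close> being the number of classes, coordinate \<open>i\<close> sits at position
    \<open>i\<close>.\<close>
  let ?g = "\<lambda>(l :: nat list) i. if i \<in> {1..num_classes n d} then l ! i else 0"
  show "states n d \<subseteq> range ?g"
  proof
    fix x assume "x \<in> states n d"
    then have "x = ?g (map x [0..<Suc (num_classes n d)])"
      by (auto simp: states_def fun_eq_iff simp del: upt_Suc)
    then show "x \<in> range ?g" by blast
  qed
qed simp

text \<open>Downward moves are restricted to positive coordinates, since truncated subtraction would
  otherwise put \<open>x\<close> itself into the set.\<close>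

definition neighbours :: "nat \<Rightarrow> nat \<Rightarrow> (nat \<Rightarrow> nat) \<Rightarrow> (nat \<Rightarrow> nat) set" where
  "neighbours n d x = (\<lambda>i. x(i := Suc (x i))) ` {1..num_classes n d} \<union>
     (\<lambda>i. x(i := x i - 1)) ` {i \<in> {1..num_classes n d}. 0 < x i}"

lemma finite_neighbours: "finite (neighbours n d x)"
  by (simp add: neighbours_def)

lemma not_in_neighbours: "x \<notin> neighbours n d x"
proof
  assume "x \<in> neighbours n d x"
  then obtain i where "x = x(i := Suc (x i)) \<or> 0 < x i \<and> x = x(i := x i - 1)"
    unfolding neighbours_def by blast
  then have "x i = Suc (x i) \<or> 0 < x i \<and> x i = x i - 1"
    by (metis fun_upd_same)
  then show False by auto
qed

lemma neighbours_states: "x \<in> states n d \<Longrightarrow> neighbours n d x \<subseteq> states n d"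
  by (auto simp: neighbours_def states_def)

text \<open>Solving for \<open>z\<close> turns the guard in \<open>jump_rate\<close> into an
  equation that picks one term of a sum over \<open>z\<close>.\<close>

lemma down_iff:
  fixes x z :: "nat \<Rightarrow> nat"
  shows "x = z(i := Suc (z i)) \<longleftrightarrow> 0 < x i \<and> z = x(i := x i - 1)"
proof
  assume eq: "x = z(i := Suc (z i))"
  show "0 < x i \<and> z = x(i := x i - 1)"
    unfolding eq by simp
qed auto

lemma jump_rate_outside_neighbours:
  assumes "z \<notin> neighbours n d x"
  shows "jump_rate n d lam C x z = 0"
  unfolding jump_rate_def
proof (intro sum.neutral ballI)
  fix i assume i: "i \<in> {1..num_classes n d}"
  have "z \<noteq> x(i := Suc (x i))"
    using assms i by (auto simp: neighbours_def)
  moreover have "x \<noteq> z(i := Suc (z i))"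
    using assms i unfolding down_iff[of x z i] neighbours_def by blast
  ultimately show "(if z = x(i := Suc (x i)) then arrival_rate n d lam else 0) +
      (if x = z(i := Suc (z i)) then departure_rate n d C i x else 0) = 0"
    by simp
qed

lemma departure_rate_0: "x i = 0 \<Longrightarrow> departure_rate n d C i x = 0"
  by (simp add: departure_rate_def)

lemma departure_rate_nonneg: "0 \<le> departure_rate n d C i x"
  by (auto simp: departure_rate_def intro!: mult_nonneg_nonneg sum_nonneg)

text \<open>The jumps are regrouped by class. The weight 1 yields the total rate, the weight
  \<open>v z - v x\<close> the generator applied to \<open>v\<close>. If \<open>x i = 0\<close>, no
  downward jump exists and the truncated term on the right has rate 0.\<close>

lemma sum_jump_rate:
  fixes w :: "(nat \<Rightarrow> nat) \<Rightarrow> real"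
  shows "(\<Sum>z\<in>neighbours n d x. jump_rate n d lam C x z * w z) =
    (\<Sum>i\<in>{1..num_classes n d}. arrival_rate n d lam * w (x(i := Suc (x i))) +
       departure_rate n d C i x * w (x(i := x i - 1)))"
proof -
  let ?I = "{1..num_classes n d}" and ?N = "neighbours n d x"
  have "(\<Sum>z\<in>?N. jump_rate n d lam C x z * w z) =
      (\<Sum>i\<in>?I. \<Sum>z\<in>?N. ((if z = x(i := Suc (x i)) then arrival_rate n d lam else 0) +
        (if x = z(i := Suc (z i)) then departure_rate n d C i x else 0)) * w z)"
    unfolding jump_rate_def sum_distrib_right by (rule sum.swap)
  also have "\<dots> = (\<Sum>i\<in>?I. arrival_rate n d lam * w (x(i := Suc (x i))) +
       departure_rate n d C i x * w (x(i := x i - 1)))"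
  proof (rule sum.cong[OF refl])
    fix i assume i: "i \<in> ?I"
    have up: "x(i := Suc (x i)) \<in> ?N"
      using i by (auto simp: neighbours_def)
    have "(\<Sum>z\<in>?N. (if z = x(i := Suc (x i)) then arrival_rate n d lam else 0) * w z) =
        (\<Sum>z\<in>?N. if z = x(i := Suc (x i)) then arrival_rate n d lam * w z else 0)"
      by (intro sum.cong) auto
    also have "\<dots> = arrival_rate n d lam * w (x(i := Suc (x i)))"
      using up by (simp add: sum.delta[OF finite_neighbours])
    finally have arr: "(\<Sum>z\<in>?N. (if z = x(i := Suc (x i)) then arrival_rate n d lam else 0) * w z) =
        arrival_rate n d lam * w (x(i := Suc (x i)))" .
    have dep: "(\<Sum>z\<in>?N. (if x = z(i := Suc (z i)) then departure_rate n d C i x else 0) * w z) =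
        departure_rate n d C i x * w (x(i := x i - 1))"
    proof (cases "x i = 0")
      case True
      then show ?thesis
        by (simp add: departure_rate_0 down_iff)
    next
      case False
      then have down: "x(i := x i - 1) \<in> ?N"
        using i by (auto simp: neighbours_def)
      have "(\<Sum>z\<in>?N. (if x = z(i := Suc (z i)) then departure_rate n d C i x else 0) * w z) =
          (\<Sum>z\<in>?N. if z = x(i := x i - 1) then departure_rate n d C i x * w z else 0)"
        using False unfolding down_iff by (intro sum.cong) auto
      also have "\<dots> = departure_rate n d C i x * w (x(i := x i - 1))"
        using down by (simp add: sum.delta[OF finite_neighbours])
      finally show ?thesis .
    qed
    show "(\<Sum>z\<in>?N. ((if z = x(i := Suc (x i)) then arrival_rate n d lam else 0) +
        (if x = z(i := Suc (z i)) then departure_rate n d C i x else 0)) * w z) =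
       arrival_rate n d lam * w (x(i := Suc (x i))) + departure_rate n d C i x * w (x(i := x i - 1))"
      unfolding distrib_right sum.distrib arr dep ..
  qed
  finally show ?thesis .
qed

text \<open>All rates into states outside \<open>neighbours n d x\<close> are 0, so the infinite sum
  is finite.\<close>

lemma generator_jump_rate:
  assumes "x \<in> states n d"
  shows "generator (states n d) (jump_rate n d lam C) x x =
    - (\<Sum>z\<in>neighbours n d x. jump_rate n d lam C x z)"
proof -
  have "(\<Sum>\<^sub>\<infinity>z\<in>states n d - {x}. jump_rate n d lam C x z) =
      (\<Sum>\<^sub>\<infinity>z\<in>neighbours n d x. jump_rate n d lam C x z)"
    using neighbours_states[OF assms] not_in_neighbours[of x n d]
    by (intro infsum_cong_neutral) (auto simp: jump_rate_outside_neighbours)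
  then show ?thesis
    by (simp add: generator_def finite_neighbours)
qed

text \<open>Grouped by server, the sum has one term load / load per server: 1 if the server is busy,
  and 0 / 0 = 0 if it is idle.\<close>

lemma sum_departure_rate_le:
  assumes "class_indexing n d C"
  shows "(\<Sum>i\<in>{1..num_classes n d}. departure_rate n d C i x) \<le> real n"
proof -
  let ?I = "{1..num_classes n d}"
  have C: "C i \<subseteq> {1..n}" if "i \<in> ?I" for i
    using assms that unfolding class_indexing_def bij_betw_def by auto
  have "(\<Sum>i\<in>?I. departure_rate n d C i x) =
      (\<Sum>i\<in>?I. \<Sum>j\<in>{1..n}. if j \<in> C i then real (x i) / real (server_load n d C x j) else 0)"
  proof (rule sum.cong[OF refl])
    fix i assume "i \<in> ?I"
    from C[OF this] have "{1..n} \<inter> C i = C i" by auto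
    then show "departure_rate n d C i x =
        (\<Sum>j\<in>{1..n}. if j \<in> C i then real (x i) / real (server_load n d C x j) else 0)"
      by (simp add: departure_rate_def sum_distrib_left sum.inter_restrict[symmetric])
  qed
  also have "\<dots> = (\<Sum>j\<in>{1..n}. \<Sum>i\<in>?I. if j \<in> C i then real (x i) / real (server_load n d C x j) else 0)"
    by (rule sum.swap)
  also have "\<dots> = (\<Sum>j\<in>{1..n}. real (server_load n d C x j) / real (server_load n d C x j))"
  proof (rule sum.cong[OF refl])
    fix j
    have "(\<Sum>i\<in>?I. if j \<in> C i then real (x i) / real (server_load n d C x j) else 0) =
        (\<Sum>i\<in>classes_of_server n d C j. real (x i) / real (server_load n d C x j))"
      unfolding classes_of_server_def by (rule sum.inter_filter[symmetric]) simp
    also have "\<dots> = real (server_load n d C x j) / real (server_load n d C x j)"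
      by (simp only: server_load_def of_nat_sum sum_divide_distrib)
    finally show "(\<Sum>i\<in>?I. if j \<in> C i then real (x i) / real (server_load n d C x j) else 0) =
        real (server_load n d C x j) / real (server_load n d C x j)" .
  qed
  also have "\<dots> \<le> (\<Sum>j\<in>{1..n}. 1)"
    by (intro sum_mono) simp
  finally show ?thesis by simp
qed

lemma departure_rate_antimono:
  assumes i: "i \<in> {1..num_classes n d}" and xy: "x \<le> y" "x i = y i"
  shows "departure_rate n d C i y \<le> departure_rate n d C i x"
proof (cases "x i = 0")
  case True
  then show ?thesis
    using xy by (simp add: departure_rate_0)
next
  case False
  have "1 / real (server_load n d C y j) \<le> 1 / real (server_load n d C x j)" if j: "j \<in> C i" for j
  proof -
    have "finite (classes_of_server n d C j)" "i \<in> classes_of_server n d C j"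
      using i j by (auto simp: classes_of_server_def)
    \<comment> \<open>This makes the load in \<open>x\<close> positive; with
      \<open>1 / 0 = 0\<close> the reciprocal would not be antitone at load 0.\<close>
    then have "x i \<le> server_load n d C x j"
      unfolding server_load_def by (intro member_le_sum) auto
    moreover have "server_load n d C x j \<le> server_load n d C y j"
      unfolding server_load_def using xy by (intro sum_mono) (auto simp: le_fun_def)
    ultimately show ?thesis
      using False by (intro divide_left_mono) auto
  qed
  then show ?thesis
    unfolding departure_rate_def using xy by (auto intro!: mult_left_mono sum_mono)
qed

lemma sum_arrival_rate_le:
  assumes "d \<le> n" "lam \<le> 1"
  shows "(\<Sum>i\<in>{1..num_classes n d}. arrival_rate n d lam) \<le> real n"
proof -
  have "0 < num_classes n d"
    using assms by (simp add: num_classes_def)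
  then have "(\<Sum>i\<in>{1..num_classes n d}. arrival_rate n d lam) = real n * lam"
    by (simp add: arrival_rate_def)
  also have "\<dots> \<le> real n"
    using assms by (simp add: mult_left_le)
  finally show ?thesis .
qed

text \<open>The drift of \<open>v x - v y\<close> due to class \<open>i\<close> in a coupling that preserves \<open>x \<le> y\<close>: arrivals
  are joint; for \<open>x i = y i\<close> every departure from \<open>y\<close> is joint with one from \<open>x\<close>; for
  \<open>x i < y i\<close> the two copies depart separately.\<close>

lemma coupled_class_drift_le:
  fixes v :: "(nat \<Rightarrow> nat) \<Rightarrow> real"
  assumes i: "i \<in> {1..num_classes n d}" and xy: "x \<in> states n d" "y \<in> states n d" "x \<le> y"
    and lam: "0 \<le> lam"
    and v: "\<And>x y. x \<in> states n d \<Longrightarrow> y \<in> states n d \<Longrightarrow> x \<le> y \<Longrightarrow> v x - v y \<le> \<delta>"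
  shows "(arrival_rate n d lam * (v (x(i := Suc (x i))) - v x) +
      departure_rate n d C i x * (v (x(i := x i - 1)) - v x)) -
    (arrival_rate n d lam * (v (y(i := Suc (y i))) - v y) +
      departure_rate n d C i y * (v (y(i := y i - 1)) - v y))
    \<le> (arrival_rate n d lam + departure_rate n d C i x + departure_rate n d C i y) *
      (\<delta> - (v x - v y))"
proof -
  let ?a = "arrival_rate n d lam" and ?p = "departure_rate n d C i x" and ?q = "departure_rate n d C i y"
  let ?xu = "x(i := Suc (x i))" and ?xd = "x(i := x i - 1)"
  let ?yu = "y(i := Suc (y i))" and ?yd = "y(i := y i - 1)"
  have st: "?xu \<in> states n d" "?xd \<in> states n d" "?yu \<in> states n d" "?yd \<in> states n d"
    using xy i by (auto simp: states_def)
  have xy_k: "x k \<le> y k" for k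
    using xy(3) by (rule le_funD)
  have xd: "x i - 1 \<le> y i" "x i - 1 \<le> y i - 1"
    using xy_k[of i] by auto
  have le: "?xu \<le> ?yu" "?xd \<le> y" "?xd \<le> ?yd"
    using xy_k xd by (simp_all add: le_fun_def)
  have a: "0 \<le> ?a"
    using lam by (simp add: arrival_rate_def)
  have p: "0 \<le> ?p" and q: "0 \<le> ?q"
    by (rule departure_rate_nonneg)+
  have up: "?a * (v ?xu - v ?yu) \<le> ?a * \<delta>"
    using v[OF st(1,3) le(1)] a by (rule mult_left_mono)
  have w: "v x - v y \<le> \<delta>"
    using v xy by blast
  have "?p * (v ?xd - v x) - ?q * (v ?yd - v y) \<le> (?p + ?q) * (\<delta> - (v x - v y))"
  proof (cases "x i = y i")
    case True
    have qp: "0 \<le> ?p - ?q"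
      using departure_rate_antimono[OF i xy(3) True, of C] by simp
    have "?q * (v ?xd - v ?yd) \<le> ?q * \<delta>"
      using v[OF st(2,4) le(3)] q by (rule mult_left_mono)
    moreover have "(?p - ?q) * (v ?xd - v y) \<le> (?p - ?q) * \<delta>"
      using v[OF st(2) xy(2) le(2)] qp by (rule mult_left_mono)
    \<comment> \<open>The joint coupling uses only the total rate \<open>?p\<close>; the surplus
      \<open>?q\<close> on the right-hand side is absorbed because the slack is nonnegative.\<close>
    moreover have "0 \<le> ?q * (\<delta> - (v x - v y))"
      using q w by (intro mult_nonneg_nonneg) auto
    ultimately show ?thesis
      by (simp add: algebra_simps)
  next
    case False
    then have "x i \<le> y i - 1"
      using xy_k[of i] by simp
    then have "x \<le> ?yd"
      using xy_k by (simp add: le_fun_def)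
    then have "?q * (v x - v ?yd) \<le> ?q * \<delta>"
      using v[OF xy(1) st(4)] q by (intro mult_left_mono) auto
    moreover have "?p * (v ?xd - v y) \<le> ?p * \<delta>"
      using v[OF st(2) xy(2) le(2)] p by (rule mult_left_mono)
    ultimately show ?thesis
      by (simp add: algebra_simps)
  qed
  with up show ?thesis
    by (simp add: algebra_simps)
qed

section \<open>Stochastic monotonicity in time of the chain started empty\<close>

theorem corollary1:
  fixes n d :: nat and lam :: real and C :: "nat \<Rightarrow> nat set"
    and M :: "'a measure" and X :: "real \<Rightarrow> 'a \<Rightarrow> nat \<Rightarrow> nat"
  assumes "1 \<le> d" and "d \<le> n" and "0 < lam" and "lam < 1"
    and "class_indexing n d C"
    and "ctmc M (states n d) (jump_rate n d lam C) X"
    and "AE \<omega> in M. X 0 \<omega> = (\<lambda>_. 0)"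
  shows "\<forall>s t. 0 \<le> s \<and> s \<le> t \<longrightarrow>
    stoch_le (distr M (count_space (states n d)) (X s)) (distr M (count_space (states n d)) (X t))"
proof -
  let ?S = "states n d" and ?r = "jump_rate n d lam C" and ?N = "neighbours n d"
    and ?I = "{1..num_classes n d}" and ?a = "arrival_rate n d lam"
    and ?dep = "departure_rate n d C" and ?o = "(\<lambda>_. 0) :: nat \<Rightarrow> nat"
  have n: "0 < real n"
    using assms(1,2) by simp
  have o: "?o \<in> ?S" and o_le: "?o \<le> x" for x
    by (auto simp: states_def le_fun_def)
  have arr: "(\<Sum>i\<in>?I. ?a) \<le> real n"
    by (rule sum_arrival_rate_le) (use assms in auto)
  note dep = sum_departure_rate_le[OF assms(5)]
  have prob: "prob_space M" and meas: "\<And>t. 0 \<le> t \<Longrightarrow> X t \<in> measurable M (count_space ?S)"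
    using assms(6) by (auto simp: ctmc_def)
  obtain p where p: "transition_function ?S p" "has_jump_rates ?S p ?r"
    and law: "\<And>t y. 0 \<le> t \<Longrightarrow> y \<in> ?S \<Longrightarrow> measure M {\<omega> \<in> space M. X t \<omega> = y} = p t ?o y"
    using ctmc_law[OF assms(6,7) o] by blast
  obtain K where K: "\<And>x. K 0 x = return_pmf x"
    "\<And>s t x. 0 \<le> s \<Longrightarrow> 0 \<le> t \<Longrightarrow> K (s + t) x = bind_pmf (K s x) (K t)"
    "\<And>t x. x \<notin> ?S \<Longrightarrow> K t x = return_pmf x"
    "\<And>t x. x \<in> ?S \<Longrightarrow> set_pmf (K t x) \<subseteq> ?S"
    and pmf_K: "\<And>t x y. 0 \<le> t \<Longrightarrow> x \<in> ?S \<Longrightarrow> y \<in> ?S \<Longrightarrow> pmf (K t x) y = p t x y"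
    by (rule transition_function_pmf[OF p(1)]) (rule that; assumption)
  have deriv: "((\<lambda>t. pmf (K t x) y) has_real_derivative generator ?S ?r x y) (at 0 within {0..})"
    if "x \<in> ?S" "y \<in> ?S" for x y
  \<comment> \<open>The derivative is one-sided, so agreement with \<open>p\<close> at nonnegative
    times suffices; the radius 1 is arbitrary.\<close>
  proof (rule has_field_derivative_transform_within[where d = 1])
    show "((\<lambda>t. p t x y) has_real_derivative generator ?S ?r x y) (at 0 within {0..})"
      using p(2) that by (simp add: has_jump_rates_def)
  qed (use that in \<open>auto simp: pmf_K\<close>)
  have Q_eq: "(\<Sum>z\<in>?N x. ?r x z * (v z - v x)) = (\<Sum>i\<in>?I. ?a * (v (x(i := Suc (x i))) - v x) +
      ?dep i x * (v (x(i := x i - 1)) - v x))" for v :: "(nat \<Rightarrow> nat) \<Rightarrow> real" and x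
    by (rule sum_jump_rate)
  \<comment> \<open>Arrivals and departures each have total rate at most \<open>n\<close>.\<close>
  interpret bounded_jump_semigroup ?S K ?r ?N "2 * real n"
  proof
    fix x y assume x: "x \<in> ?S"
    show "((\<lambda>t. pmf (K t x) x) has_real_derivative - (\<Sum>y\<in>?N x. ?r x y)) (at 0 within {0..})"
      using deriv[OF x x] by (simp add: generator_jump_rate[OF x])
    show "(\<Sum>y\<in>?N x. ?r x y) \<le> 2 * real n"
      using sum_jump_rate[where x = x and w = "\<lambda>_. 1" and lam = lam and C = C] arr dep[of x] by (simp add: sum.distrib)
    assume y: "y \<in> ?N x"
    then have "y \<in> ?S" "x \<noteq> y"
      using neighbours_states[OF x] not_in_neighbours[of x n d] by auto
    then show "((\<lambda>t. pmf (K t x) y) has_real_derivative ?r x y) (at 0 within {0..})"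
      using deriv[OF x \<open>y \<in> ?S\<close>] by (simp add: generator_def)
  qed (rule K finite_neighbours not_in_neighbours; assumption | simp)+
  \<comment> \<open>The coupling charges rate \<open>n\<close> each to the joint arrivals, the
    departures from \<open>x\<close> and those from \<open>y\<close>. For \<open>h\<close> up to
    \<open>1 / (3 * n)\<close> the coupled Euler step is still an average with nonnegative
    weights.\<close>
  interpret monotone_jump_semigroup ?S K ?r ?N "2 * real n" "1 / (3 * real n)"
  proof
    show "0 < 1 / (3 * real n)"
      using n by simp
    fix h \<delta> :: real and x y :: "nat \<Rightarrow> nat" and v :: "(nat \<Rightarrow> nat) \<Rightarrow> real"
    assume h: "0 < h" "h \<le> 1 / (3 * real n)" and xy: "x \<in> ?S" "y \<in> ?S" "x \<le> y"
      and v: "\<And>x y. x \<in> ?S \<Longrightarrow> y \<in> ?S \<Longrightarrow> x \<le> y \<Longrightarrow> v x - v y \<le> \<delta>"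
    \<comment> \<open>\<open>w\<close> is the slack left by the bound \<open>\<delta>\<close>; the
      drift over a step uses at most the fraction \<open>h * (3 * n)\<close> of it.\<close>
    define w where "w = \<delta> - (v x - v y)"
    have w: "0 \<le> w"
      using v[OF xy] by (simp add: w_def)
    have "Q v x - Q v y \<le> (\<Sum>i\<in>?I. (?a + ?dep i x + ?dep i y) * w)"
      unfolding Q_def Q_eq sum_subtractf[symmetric] w_def
      by (rule sum_mono, rule coupled_class_drift_le) (use xy v assms(3) in auto)
    also have "\<dots> = ((\<Sum>i\<in>?I. ?a) + (\<Sum>i\<in>?I. ?dep i x) + (\<Sum>i\<in>?I. ?dep i y)) * w"
      by (simp only: sum_distrib_right sum.distrib distrib_right)
    also have "\<dots> \<le> (3 * real n) * w"
      using arr dep[of x] dep[of y] w by (intro mult_right_mono) auto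
    finally have "h * (Q v x - Q v y) \<le> h * ((3 * real n) * w)"
      using h by (intro mult_left_mono) auto
    also have "\<dots> = (h * (3 * real n)) * w"
      by simp
    also have "\<dots> \<le> 1 * w"
      using h n w by (intro mult_right_mono) (auto simp: field_simps)
    finally show "(v x + h * Q v x) - (v y + h * Q v y) \<le> \<delta>"
      by (simp add: w_def algebra_simps)
  qed
  have distr: "distr M (count_space UNIV) (X t) = measure_pmf (K t ?o)" if "0 \<le> t" for t
    by (rule distr_eq_pmf[OF prob meas[OF that] countable_states set_K[OF o]])
      (simp add: law pmf_K that o)
  show ?thesis
  proof (intro allI impI)
    fix s t :: real assume st: "0 \<le> s \<and> s \<le> t"
    then have t: "0 \<le> t" by simp
    have s: "0 \<le> s" using st by simp
    note integral_eq = distr_count_space_integral[OF meas[OF t], unfolded distr[OF t]]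
      distr_count_space_integral[OF meas[OF s], unfolded distr[OF s]]
    show "stoch_le (distr M (count_space ?S) (X s)) (distr M (count_space ?S) (X t))"
      unfolding stoch_le_def integral_eq space_distr space_count_space Un_absorb
      by (intro allI impI, elim conjE, rule expectation_from_bot_mono[OF _ _ _ o o_le])
        (use s st in auto)
  qed
qed

end
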